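(* Assume that $\log p/n=o(1)$ as $n\to\infty$, that there is a constant $\sigma>3\eta>0$ with $\phi_{\max}\ge \phi_j+\sigma$ for all $j\ge 2$, and that $\{\bm X_t\}_{t\in\mathbb Z}$ is a zero-mean, $\alpha$-mixing, stationary Gaussian process. Let $b>0$, let $c>0$ be the constant described in the context, and assume $p>6$ and $\tilde\zeta_n^2<\tilde\zeta_n$, where $\tilde\zeta_n:=\sqrt{(b+4\tilde s)\log p/(cn)}$. Suppose moreover that $\sum_{l=0}^\infty\rho(l)<\infty$, that $\log p\to\infty$ as $n\to\infty$, and that \[ \lambda_0\asymp\phi_{\max}^2\frac{\log p}{n}. \] Then \[ \|\hat{\bm\beta}_n^0-\bm\beta^0\|_2^2=O_p\left(\tilde s\,\phi_{\max}^4\,\frac{\log p}{n}\right),\qquad n\to\infty. \]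
   Context: $\{\bm X_t\}_{t\in\mathbb Z}$ is an $\mathbb R^p$-valued, strictly stationary, centered time series, with $p=p(n)$ allowed to depend on the sample size $n$; $\bm X_1,\dots,\bm X_n$ are observed. Put $\Sigma_0=E[\bm X_t\bm X_t^\top]$ and $\hat\Sigma_n=\frac1n\sum_{t=1}^n\bm X_t\bm X_t^\top$. The eigenvalues of $\Sigma_0$ are written $\phi_1^2\ge\dots\ge\phi_p^2$ with $\phi_1\ge\dots\ge\phi_p\ge0$, and $\phi_{\max}:=\phi_1$ (so $\phi_{\max}^2$ is the largest eigenvalue of $\Sigma_0$). Let $\bm q^0$ be a unit ($l_2$) eigenvector of $\Sigma_0$ for $\phi_{\max}^2$ and $\bm\beta^0:=\phi_{\max}\bm q^0$. Let $S=\{j:\bm\beta^0_j\ne0\}$ and $s_0=|S|$. For a constant $\eta>0$ let $\mathcal B=\{\bm\beta\in\mathbb R^p:\|\bm\beta-\bm\beta^0\|_2\le\eta\}$. Let $R_n(\bm\beta):=-\frac12\bm\beta^\top\hat\Sigma_n\bm\beta+\frac14\|\bm\beta\|_2^4$ and $\|\bm\beta\|_0$ the number of nonzero entries of $\bm\beta$. For a tuning parameter $\lambda_0\ge0$ (depending on $n$), the $l_0$-penalized estimator is \[ \hat{\bm\beta}_n^0:=\arg\min_{\bm\beta\in\mathcal B}\{R_n(\bm\beta)+\lambda_0\|\bm\beta\|_0\} \] (equivalently, the minimizer over $\mathcal B$ of $\frac14\|\hat\Sigma_n-\bm\beta\bm\beta^\top\|_F^2+\lambda_0\|\bm\beta\|_0$).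 The constant $s\ge0$ is a nonnegative constant such that $\hat{\bm\beta}_n^0=\arg\min_{\bm\beta\in\mathcal B\cap\mathcal B_0(s)}R_n(\bm\beta)$, where $\mathcal B_0(s):=\{\bm\beta\in\mathbb R^p:\|\bm\beta\|_0\le s\}$; and $\tilde s:=\max\{s_0,s\}$. Mixing: $\alpha(l):=\sup\{|P(A\cap B)-P(A)P(B)|: A\in\sigma(\bm X_s,s\le t),\,B\in\sigma(\bm X_s,s\ge t+l),\ t\in\mathbb Z\}$, and the process is $\alpha$-mixing if $\alpha(l)\to0$ as $l\to\infty$. The $\rho$-mixing coefficients are $\rho(l):=\sup\{\mathrm{Cov}(f(\bm X_t),g(\bm X_{t+l})):E[f]=E[g]=0,\ E[f^2]=E[g^2]=1\}$. The constant $c>0$ is a constant for which the following oracle inequality holds: for every $b>0$, with $\tilde\gamma_n:=\phi_{\max}\tilde\zeta_n\sum_{l=0}^n\rho(l)$, for every $p>6$ and $n$ with $\tilde\zeta_n^2<\tilde\zeta_n$, with probability at least $1-\exp(-b\log p)$ one has $\|\hat{\bm\beta}_n^0-\bm\beta^0\|_2\le\bigl(\tilde\gamma_n\phi_{\max}+\sqrt{\tilde\gamma_n^2\phi_{\max}^2+4(\sigma-3\eta-\tilde\gamma_n)\tilde s\lambda_0}\bigr)/\bigl(2(\sigma-3\eta-\tilde\gamma_n)\bigr)$. $a_n\asymp b_n$ means that $a_n/b_n$ is bounded above and below by positive constants. *)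

theory Defs
  imports
    "HOL-Probability.Probability"
    "HOL-Library.Landau_Symbols"
    "Jordan_Normal_Form.Char_Poly"
begin

(* HOL-Analysis uses "$" and the bullet for its own, type-indexed vectors; the dimension here
   varies with the sample size, so vectors and matrices are those of Jordan_Normal_Form. *)
unbundle no vec_syntax
no_notation inner (infix \<open>\<bullet>\<close> 70)
hide_type (open) Finite_Cartesian_Product.vec
hide_const (open) Finite_Cartesian_Product.vec Finite_Cartesian_Product.mat


section \<open>Vectors\<close>

definition l2_norm :: "real vec \<Rightarrow> real" where
  "l2_norm v = sqrt (v \<bullet> v)"

definition vsupport :: "real vec \<Rightarrow> nat set" where
  "vsupport v = {j. j < dim_vec v \<and> v $ j \<noteq> 0}"

definition l0_norm :: "real vec \<Rightarrow> nat" where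
  "l0_norm v = card (vsupport v)"

definition vball :: "real vec \<Rightarrow> real \<Rightarrow> real vec set" where
  "vball \<beta>0 \<eta> = {\<beta> \<in> carrier_vec (dim_vec \<beta>0). l2_norm (\<beta> - \<beta>0) \<le> \<eta>}"

(* The Borel sigma-algebra of R^d, transported from the product of d real lines. *)
definition vec_borel :: "nat \<Rightarrow> real vec measure" where
  "vec_borel d = vimage_algebra (carrier_vec d) (\<lambda>v. \<lambda>i\<in>{..<d}. v $ i) (Pi\<^sub>M {..<d} (\<lambda>_. borel))"


section \<open>Vector-valued time series\<close>

definition time_series :: "'w measure \<Rightarrow> nat \<Rightarrow> (int \<Rightarrow> 'w \<Rightarrow> real vec) \<Rightarrow> bool" where
  "time_series M d X \<longleftrightarrow> prob_space M \<and> (\<forall>t. X t \<in> measurable M (vec_borel d))"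

definition strictly_stationary :: "'w measure \<Rightarrow> nat \<Rightarrow> (int \<Rightarrow> 'w \<Rightarrow> real vec) \<Rightarrow> bool" where
  "strictly_stationary M d X \<longleftrightarrow>
     (\<forall>I h. finite I \<longrightarrow>
        distr M (Pi\<^sub>M I (\<lambda>_. vec_borel d)) (\<lambda>\<omega>. \<lambda>t\<in>I. X (t + h) \<omega>) =
        distr M (Pi\<^sub>M I (\<lambda>_. vec_borel d)) (\<lambda>\<omega>. \<lambda>t\<in>I. X t \<omega>))"

definition centered :: "'w measure \<Rightarrow> nat \<Rightarrow> (int \<Rightarrow> 'w \<Rightarrow> real vec) \<Rightarrow> bool" where
  "centered M d X \<longleftrightarrow>
     (\<forall>t. \<forall>j<d. integrable M (\<lambda>\<omega>. X t \<omega> $ j) \<and> (\<integral>\<omega>. X t \<omega> $ j \<partial>M) = 0)"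

(* Degenerate normal laws (point masses) are included. *)
definition gaussian_rv :: "'w measure \<Rightarrow> ('w \<Rightarrow> real) \<Rightarrow> bool" where
  "gaussian_rv M Y \<longleftrightarrow> Y \<in> borel_measurable M \<and>
     ((\<exists>\<mu>. AE \<omega> in M. Y \<omega> = \<mu>) \<or>
      (\<exists>\<mu> \<tau>. \<tau> > 0 \<and> distributed M lborel Y (\<lambda>x. ennreal (normal_density \<mu> \<tau> x))))"

(* All finite-dimensional distributions are multivariate normal, i.e. every linear combination
   of finitely many coordinates at finitely many times is univariate normal. *)
definition gaussian_process :: "'w measure \<Rightarrow> nat \<Rightarrow> (int \<Rightarrow> 'w \<Rightarrow> real vec) \<Rightarrow> bool" where
  "gaussian_process M d X \<longleftrightarrow>
     (\<forall>I a. finite I \<longrightarrow> (\<forall>t\<in>I. a t \<in> carrier_vec d) \<longrightarrow>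
        gaussian_rv M (\<lambda>\<omega>. \<Sum>t\<in>I. a t \<bullet> X t \<omega>))"

(* The sigma-algebra generated by X_t for t in T. *)
definition generated_events ::
    "'w measure \<Rightarrow> nat \<Rightarrow> (int \<Rightarrow> 'w \<Rightarrow> real vec) \<Rightarrow> int set \<Rightarrow> 'w set set" where
  "generated_events M d X T =
     sigma_sets (space M) {X t -` A \<inter> space M | t A. t \<in> T \<and> A \<in> sets (vec_borel d)}"

definition alpha_coeff :: "'w measure \<Rightarrow> nat \<Rightarrow> (int \<Rightarrow> 'w \<Rightarrow> real vec) \<Rightarrow> nat \<Rightarrow> real" where
  "alpha_coeff M d X l =
     Sup {\<bar>measure M (A \<inter> B) - measure M A * measure M B\<bar> | A B t.
            A \<in> generated_events M d X {..t} \<and> B \<in> generated_events M d X {t + int l..}}"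

definition alpha_mixing :: "'w measure \<Rightarrow> nat \<Rightarrow> (int \<Rightarrow> 'w \<Rightarrow> real vec) \<Rightarrow> bool" where
  "alpha_mixing M d X \<longleftrightarrow> alpha_coeff M d X \<longlonglongrightarrow> 0"

definition covariance :: "'w measure \<Rightarrow> ('w \<Rightarrow> real) \<Rightarrow> ('w \<Rightarrow> real) \<Rightarrow> real" where
  "covariance M Y Z =
     (\<integral>\<omega>. (Y \<omega> - (\<integral>\<omega>'. Y \<omega>' \<partial>M)) * (Z \<omega> - (\<integral>\<omega>'. Z \<omega>' \<partial>M)) \<partial>M)"

(* A Bochner integral equal to 1 is that of an integrable function, so f and g are
   square-integrable, hence integrable, and no separate integrability clause is needed. *)
definition rho_coeff :: "'w measure \<Rightarrow> nat \<Rightarrow> (int \<Rightarrow> 'w \<Rightarrow> real vec) \<Rightarrow> nat \<Rightarrow> real" where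
  "rho_coeff M d X l =
     Sup {covariance M (\<lambda>\<omega>. f (X t \<omega>)) (\<lambda>\<omega>. g (X (t + int l) \<omega>)) | f g t.
            f \<in> borel_measurable (vec_borel d) \<and> g \<in> borel_measurable (vec_borel d) \<and>
            (\<integral>\<omega>. f (X t \<omega>) \<partial>M) = 0 \<and> (\<integral>\<omega>. g (X (t + int l) \<omega>) \<partial>M) = 0 \<and>
            (\<integral>\<omega>. (f (X t \<omega>))\<^sup>2 \<partial>M) = 1 \<and> (\<integral>\<omega>. (g (X (t + int l) \<omega>))\<^sup>2 \<partial>M) = 1}"


section \<open>Population and sample covariance matrices\<close>

(* By stationarity any time t gives the same matrix; t = 0 is used. *)
definition Sigma0 :: "'w measure \<Rightarrow> nat \<Rightarrow> (int \<Rightarrow> 'w \<Rightarrow> real vec) \<Rightarrow> real mat" where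
  "Sigma0 M d X = mat d d (\<lambda>(i, j). \<integral>\<omega>. X 0 \<omega> $ i * X 0 \<omega> $ j \<partial>M)"

definition Sigma_hat :: "nat \<Rightarrow> nat \<Rightarrow> (int \<Rightarrow> 'w \<Rightarrow> real vec) \<Rightarrow> 'w \<Rightarrow> real mat" where
  "Sigma_hat n d X \<omega> =
     mat d d (\<lambda>(i, j). (\<Sum>t=1..n. X (int t) \<omega> $ i * X (int t) \<omega> $ j) / real n)"

(* The eigenvalues of the d x d matrix A, counted with multiplicity, are
   phi_1^2 >= ... >= phi_d^2 with phi_1 >= ... >= phi_d >= 0. *)
definition eigenvalue_roots :: "real mat \<Rightarrow> nat \<Rightarrow> (nat \<Rightarrow> real) \<Rightarrow> bool" where
  "eigenvalue_roots A d \<phi> \<longleftrightarrow>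
     char_poly A = (\<Prod>j=1..d. [: - ((\<phi> j)\<^sup>2), 1 :]) \<and>
     (\<forall>i j. 1 \<le> i \<longrightarrow> i \<le> j \<longrightarrow> j \<le> d \<longrightarrow> \<phi> j \<le> \<phi> i) \<and>
     (\<forall>j. 1 \<le> j \<longrightarrow> j \<le> d \<longrightarrow> 0 \<le> \<phi> j)"

definition risk :: "real mat \<Rightarrow> real vec \<Rightarrow> real" where
  "risk S \<beta> = - (1/2) * (\<beta> \<bullet> (S *\<^sub>v \<beta>)) + (1/4) * (l2_norm \<beta>) ^ 4"


section \<open>Rates\<close>

definition zeta_tilde :: "real \<Rightarrow> real \<Rightarrow> real \<Rightarrow> nat \<Rightarrow> nat \<Rightarrow> real" where
  "zeta_tilde b c s d n = sqrt ((b + 4 * s) * ln (real d) / (c * real n))"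

definition gamma_tilde ::
    "real \<Rightarrow> real \<Rightarrow> real \<Rightarrow> nat \<Rightarrow> nat \<Rightarrow> real \<Rightarrow> (nat \<Rightarrow> real) \<Rightarrow> real" where
  "gamma_tilde b c s d n \<phi>max \<rho> = \<phi>max * zeta_tilde b c s d n * (\<Sum>l=0..n. \<rho> l)"

(* Meaningful only for gamma < sigma - 3 eta: otherwise the denominator is zero or negative. *)
definition oracle_bound :: "real \<Rightarrow> real \<Rightarrow> real \<Rightarrow> real \<Rightarrow> real \<Rightarrow> real \<Rightarrow> real" where
  "oracle_bound \<sigma> \<eta> \<gamma> \<phi>max s lam0 =
     (\<gamma> * \<phi>max + sqrt (\<gamma>\<^sup>2 * \<phi>max\<^sup>2 + 4 * (\<sigma> - 3 * \<eta> - \<gamma>) * s * lam0)) /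
     (2 * (\<sigma> - 3 * \<eta> - \<gamma>))"

(* Y n = O_p(a n) as n tends to infinity, for Y n defined on the probability space M n. *)
definition big_O_p :: "(nat \<Rightarrow> 'w measure) \<Rightarrow> (nat \<Rightarrow> 'w \<Rightarrow> real) \<Rightarrow> (nat \<Rightarrow> real) \<Rightarrow> bool" where
  "big_O_p M Y a \<longleftrightarrow>
     (\<forall>n\<ge>1. Y n \<in> borel_measurable (M n)) \<and>
     (\<forall>\<epsilon>>0. \<exists>K>0. \<forall>\<^sub>F n in sequentially.
        measure (M n) {\<omega> \<in> space (M n). \<bar>Y n \<omega>\<bar> \<le> K * \<bar>a n\<bar>} \<ge> 1 - \<epsilon>)"

end

theory Submission
  imports Defs
begin

text \<open>The penalty term and the square of the deviation term of the oracle bound are both at most a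
  constant times \<open>s_tilde * \<phi>\<^sub>1 ^ 4 * ln p / n\<close>: the spectral gap forces \<open>\<phi>\<^sub>1 \<ge> \<sigma>\<close>, so
  \<open>\<beta>0\<close> is nonzero, \<open>s_tilde \<ge> 1\<close> and \<open>b + 4 * s_tilde \<le> (b + 4) * s_tilde\<close>. If
  \<open>\<gamma> < (\<sigma> - 3 * \<eta>) / 2\<close>, the oracle inequality applies with a denominator bounded away from zero.
  Otherwise \<open>\<gamma>\<^sup>2\<close>, and with it the rate, is bounded below, and the trivial bound \<open>\<eta>\<close> on the
  estimation error suffices.\<close>

section \<open>Measurability of the squared error, and supports of nonzero vectors\<close>

lemma space_vec_borel [simp]: "space (vec_borel d) = carrier_vec d"
  by (simp add: vec_borel_def)

lemma vec_borel_component [measurable]: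
  assumes "i < d"
  shows "(\<lambda>v. v $ i) \<in> borel_measurable (vec_borel d)"
proof -
  have "(\<lambda>v. \<lambda>i\<in>{..<d}. v $ i) \<in> measurable (vec_borel d) (Pi\<^sub>M {..<d} (\<lambda>_. borel :: real measure))"
    unfolding vec_borel_def by (rule measurable_vimage_algebra1) (auto simp: space_PiM)
  from measurable_compose[OF this measurable_component_singleton[of i]] assms
  show ?thesis by simp
qed

lemma l2_norm_nonneg: "0 \<le> l2_norm v"
  by (simp add: l2_norm_def scalar_prod_def sum_nonneg)

lemma l2_norm_diff_sq:
  assumes "v \<in> carrier_vec d" "w \<in> carrier_vec d"
  shows "(l2_norm (v - w))\<^sup>2 = (\<Sum>j<d. (v $ j - w $ j)\<^sup>2)"
proof -
  have "(v - w) \<bullet> (v - w) = (\<Sum>j<d. (v $ j - w $ j)\<^sup>2)"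
    using assms by (auto simp: scalar_prod_def power2_eq_square atLeast0LessThan intro!: sum.cong)
  then show ?thesis
    by (simp add: l2_norm_def sum_nonneg)
qed

text \<open>Serves the measurability clause of \<open>big_O_p\<close>. The coordinate sum is
  measurable, and it agrees with the squared norm on \<open>space N\<close>, where \<open>Y\<close>
  is known to have dimension \<open>d\<close>.\<close>

lemma borel_measurable_l2_norm_diff_sq:
  assumes "Y \<in> measurable N (vec_borel d)" "w \<in> carrier_vec d"
  shows "(\<lambda>\<omega>. (l2_norm (Y \<omega> - w))\<^sup>2) \<in> borel_measurable N"
proof -
  have "(\<lambda>\<omega>. \<Sum>j<d. (Y \<omega> $ j - w $ j)\<^sup>2) \<in> borel_measurable N"
  proof (rule borel_measurable_sum)
    fix j assume "j \<in> {..<d}"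
    then have [measurable]: "(\<lambda>\<omega>. Y \<omega> $ j) \<in> borel_measurable N"
      using measurable_compose[OF assms(1) vec_borel_component] by simp
    show "(\<lambda>\<omega>. (Y \<omega> $ j - w $ j)\<^sup>2) \<in> borel_measurable N" by measurable
  qed
  then show ?thesis
    by (rule measurable_cong[THEN iffD1, rotated])
      (use measurable_space[OF assms(1)] assms(2) in \<open>simp add: l2_norm_diff_sq[of _ d]\<close>)
qed

lemma l0_norm_pos:
  assumes "l2_norm v \<noteq> 0"
  shows "0 < l0_norm v"
proof -
  have "\<exists>j<dim_vec v. v $ j \<noteq> 0"
    by (rule ccontr) (use assms in \<open>simp add: l2_norm_def scalar_prod_def\<close>)
  then show ?thesis
    by (auto simp: l0_norm_def vsupport_def card_gt_0_iff)
qed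

section \<open>Nonnegativity of the rho-mixing coefficients\<close>

text \<open>With both second moments equal to 1, the pointwise bound
  \<open>\<bar>f g\<bar> \<le> (f^2 + g^2) / 2\<close> replaces Cauchy-Schwarz. It bounds the set of
  covariances whose supremum is \<open>rho_coeff\<close>.\<close>

lemma expectation_mult_le_1:
  fixes f g :: "'a \<Rightarrow> real"
  assumes [measurable]: "f \<in> borel_measurable N" "g \<in> borel_measurable N"
    and f: "(\<integral>x. (f x)\<^sup>2 \<partial>N) = 1" and g: "(\<integral>x. (g x)\<^sup>2 \<partial>N) = 1"
  shows "(\<integral>x. f x * g x \<partial>N) \<le> 1"
proof -
  \<comment> \<open>A non-integrable function has Bochner integral 0, so the value 1 forces
    integrability.\<close>
  have int: "integrable N (\<lambda>x. (f x)\<^sup>2)" "integrable N (\<lambda>x. (g x)\<^sup>2)"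
    using f g not_integrable_integral_eq by fastforce+
  have le: "\<bar>f x * g x\<bar> \<le> ((f x)\<^sup>2 + (g x)\<^sup>2) / 2" for x
  proof -
    have "0 \<le> (f x + g x)\<^sup>2" "0 \<le> (f x - g x)\<^sup>2" by simp_all
    then show ?thesis by (auto simp: power2_eq_square algebra_simps abs_le_iff)
  qed
  have int2: "integrable N (\<lambda>x. ((f x)\<^sup>2 + (g x)\<^sup>2) / 2)"
    using int by simp
  have "integrable N (\<lambda>x. f x * g x)"
    by (rule Bochner_Integration.integrable_bound[OF int2]) (use le in \<open>auto intro: order_trans\<close>)
  then have "(\<integral>x. f x * g x \<partial>N) \<le> (\<integral>x. ((f x)\<^sup>2 + (g x)\<^sup>2) / 2 \<partial>N)"
    by (rule integral_mono[OF _ int2]) (rule order_trans[OF abs_ge_self le])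
  also have "\<dots> = 1"
    using int f g by simp
  finally show ?thesis .
qed

text \<open>The supremum of an empty set of reals is a junk value, so nonnegativity requires an admissible
  \<open>f\<close>; replacing \<open>f\<close> by \<open>-f\<close> changes the sign of the covariance.\<close>

lemma rho_coeff_nonneg:
  fixes f :: "real vec \<Rightarrow> real"
  assumes series: "time_series N d X"
    and f [measurable]: "f \<in> borel_measurable (vec_borel d)"
    and mean: "\<And>t. (\<integral>\<omega>. f (X t \<omega>) \<partial>N) = 0"
    and var: "\<And>t. (\<integral>\<omega>. (f (X t \<omega>))\<^sup>2 \<partial>N) = 1"
  shows "0 \<le> rho_coeff N d X l"
proof -
  have [measurable]: "X t \<in> measurable N (vec_borel d)" for t
    using series by (auto simp: time_series_def)
  define A where "A = {covariance N (\<lambda>\<omega>. f (X t \<omega>)) (\<lambda>\<omega>. g (X (t + int l) \<omega>)) | f g t.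
            f \<in> borel_measurable (vec_borel d) \<and> g \<in> borel_measurable (vec_borel d) \<and>
            (\<integral>\<omega>. f (X t \<omega>) \<partial>N) = 0 \<and> (\<integral>\<omega>. g (X (t + int l) \<omega>) \<partial>N) = 0 \<and>
            (\<integral>\<omega>. (f (X t \<omega>))\<^sup>2 \<partial>N) = 1 \<and> (\<integral>\<omega>. (g (X (t + int l) \<omega>))\<^sup>2 \<partial>N) = 1}"
  \<comment> \<open>\<open>Sup\<close> is an upper bound only of a set bounded above. Since the
    means vanish, each covariance is the expectation of a product.\<close>
  have "x \<le> 1" if "x \<in> A" for x
  proof -
    from that[unfolded A_def mem_Collect_eq] show ?thesis
    proof (elim exE conjE)
      fix f g t
      assume x: "x = covariance N (\<lambda>\<omega>. f (X t \<omega>)) (\<lambda>\<omega>. g (X (t + int l) \<omega>))"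
      and [measurable]: "f \<in> borel_measurable (vec_borel d)" "g \<in> borel_measurable (vec_borel d)"
      and *: "(\<integral>\<omega>. f (X t \<omega>) \<partial>N) = 0" "(\<integral>\<omega>. g (X (t + int l) \<omega>) \<partial>N) = 0"
        "(\<integral>\<omega>. (f (X t \<omega>))\<^sup>2 \<partial>N) = 1" "(\<integral>\<omega>. (g (X (t + int l) \<omega>))\<^sup>2 \<partial>N) = 1"
      show ?thesis
        unfolding x covariance_def * diff_0_right by (rule expectation_mult_le_1) (use * in auto)
    qed
  qed
  then have bdd: "bdd_above A" by (auto simp: bdd_above_def)
  let ?x = "covariance N (\<lambda>\<omega>. f (X 0 \<omega>)) (\<lambda>\<omega>. f (X (0 + int l) \<omega>))"
  have "?x \<in> A"
    unfolding A_def mem_Collect_eq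
    by (rule exI[of _ f], rule exI[of _ f], rule exI[of _ 0]) (simp add: mean var)
  moreover have "- ?x \<in> A"
  proof -
    have "- ?x = covariance N (\<lambda>\<omega>. - f (X 0 \<omega>)) (\<lambda>\<omega>. f (X (0 + int l) \<omega>))"
      by (simp add: covariance_def mean)
    moreover have "(\<lambda>v. - f v) \<in> borel_measurable (vec_borel d)" by measurable
    moreover have "(\<integral>\<omega>. - f (X 0 \<omega>) \<partial>N) = 0" "(\<integral>\<omega>. (- f (X 0 \<omega>))\<^sup>2 \<partial>N) = 1"
      by (simp_all add: mean var)
    ultimately show ?thesis
      unfolding A_def mem_Collect_eq using f mean var
      by - (rule exI[of _ "\<lambda>v. - f v"], rule exI[of _ f], rule exI[of _ 0], auto)
  qed
  ultimately have "?x \<le> Sup A" "- ?x \<le> Sup A"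
    using bdd by (auto intro: cSup_upper)
  then show ?thesis
    by (simp add: rho_coeff_def A_def)
qed

text \<open>Stationarity for the index set \<open>{0}\<close> and shift \<open>t\<close> equates the
  one-time marginal laws.\<close>

lemma integral_stationary:
  fixes f :: "real vec \<Rightarrow> real"
  assumes series: "time_series N d X" and stat: "strictly_stationary N d X"
    and [measurable]: "f \<in> borel_measurable (vec_borel d)"
  shows "(\<integral>\<omega>. f (X t \<omega>) \<partial>N) = (\<integral>\<omega>. f (X 0 \<omega>) \<partial>N)"
proof -
  have [measurable]: "X t \<in> measurable N (vec_borel d)" for t
    using series by (auto simp: time_series_def)
  let ?P = "Pi\<^sub>M {0::int} (\<lambda>_. vec_borel d)"
  have distr: "(\<integral>\<omega>. f (X h \<omega>) \<partial>N) = (\<integral>x. f (x 0) \<partial>distr N ?P (\<lambda>\<omega>. \<lambda>t\<in>{0}. X (t + h) \<omega>))" for h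
    by (subst integral_distr) (auto intro!: measurable_restrict measurable_compose[OF measurable_component_singleton])
  have "distr N ?P (\<lambda>\<omega>. \<lambda>t\<in>{0}. X (t + t') \<omega>) = distr N ?P (\<lambda>\<omega>. \<lambda>t\<in>{0}. X t \<omega>)" for t'
    using stat unfolding strictly_stationary_def by blast
  from this[of t] this[of 0] show ?thesis
    unfolding distr by simp
qed

text \<open>A centered Gaussian coordinate is either almost surely 0, which would annihilate the
  cross moment, or normal with positive variance. Gaussianity also excludes a non-integrable square,
  whose integral would be 0 by default.\<close>

lemma gaussian_coordinate_variance_pos:
  assumes series: "time_series N d X" and mean: "centered N d X" and gauss: "gaussian_process N d X"
    and i: "i < d" and nonzero: "(\<integral>\<omega>. X t \<omega> $ i * X t \<omega> $ j \<partial>N) \<noteq> 0"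
  shows "0 < (\<integral>\<omega>. (X t \<omega> $ i)\<^sup>2 \<partial>N)"
proof -
  interpret prob_space N using series by (simp add: time_series_def)
  have X [measurable]: "X t \<in> measurable N (vec_borel d)"
    using series by (auto simp: time_series_def)
  \<comment> \<open>The coordinate is written as a linear combination, the form
    \<open>gaussian_process\<close> speaks of; the two agree on \<open>space N\<close>.\<close>
  define Y where "Y \<omega> = unit_vec d i \<bullet> X t \<omega>" for \<omega>
  have Y: "Y \<omega> = X t \<omega> $ i" if "\<omega> \<in> space N" for \<omega>
    using measurable_space[OF X that] i by (simp add: Y_def)
  have EY: "(\<integral>\<omega>. Y \<omega> \<partial>N) = 0"
    using mean i by (simp add: centered_def Y cong: Bochner_Integration.integral_cong)
  have Y2: "(\<integral>\<omega>. (Y \<omega>)\<^sup>2 \<partial>N) = (\<integral>\<omega>. (X t \<omega> $ i)\<^sup>2 \<partial>N)"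
    by (simp add: Y cong: Bochner_Integration.integral_cong)
  have "gaussian_rv N (\<lambda>\<omega>. \<Sum>t\<in>{t}. unit_vec d i \<bullet> X t \<omega>)"
    using gauss[unfolded gaussian_process_def, rule_format, of "{t}" "\<lambda>_. unit_vec d i"] by simp
  then have gY: "gaussian_rv N Y" by (simp add: Y_def[abs_def])
  then have [measurable]: "Y \<in> borel_measurable N" by (simp add: gaussian_rv_def)
  show ?thesis
    using gY unfolding gaussian_rv_def
  proof (elim conjE disjE exE)
    fix \<mu> assume ae: "AE \<omega> in N. Y \<omega> = \<mu>"
    have "(\<integral>\<omega>. Y \<omega> \<partial>N) = (\<integral>\<omega>. \<mu> \<partial>N)"
      using ae by (intro integral_cong_AE) auto
    then have "\<mu> = 0" using EY by (simp add: prob_space)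
    have "AE \<omega> in N. X t \<omega> $ i * X t \<omega> $ j = 0"
      using ae AE_space by eventually_elim (use Y \<open>\<mu> = 0\<close> in auto)
    then have "(\<integral>\<omega>. X t \<omega> $ i * X t \<omega> $ j \<partial>N) = 0"
      by (rule integral_eq_zero_AE)
    with nonzero show ?thesis by simp
  next
    fix \<mu> \<tau> :: real
    assume \<tau>: "0 < \<tau>" and dist: "distributed N lborel Y (\<lambda>x. ennreal (normal_density \<mu> \<tau> x))"
    have "variance Y = \<tau>\<^sup>2"
      using normal_distributed_variance[OF \<tau> dist] .
    then have "(\<integral>\<omega>. (Y \<omega>)\<^sup>2 \<partial>N) = \<tau>\<^sup>2" by (simp add: EY)
    with \<tau> show ?thesis by (simp add: Y2)
  qed
qed

text \<open>A nonzero eigenvalue gives \<open>Sigma0\<close> a nonzero entry, hence some coordinate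
  has positive variance. That coordinate, standardized, is the admissible function required by
  \<open>rho_coeff_nonneg\<close>.\<close>

lemma rho_coeff_nonneg_gaussian:
  assumes series: "time_series N d X" and stat: "strictly_stationary N d X"
    and mean: "centered N d X" and gauss: "gaussian_process N d X"
    and ev: "eigenvector (Sigma0 N d X) q k" and k: "k \<noteq> 0"
  shows "0 \<le> rho_coeff N d X l"
proof -
  have q: "q \<in> carrier_vec d" "q \<noteq> 0\<^sub>v d" "Sigma0 N d X *\<^sub>v q = k \<cdot>\<^sub>v q"
    using ev by (auto simp: eigenvector_def Sigma0_def)
  obtain i where i: "i < d" "q $ i \<noteq> 0"
    using q(1,2) by (metis carrier_vecD eq_vecI index_zero_vec)
  \<comment> \<open>Row \<open>i\<close> of the eigenvector equation has a nonzero left side, so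
    some summand on the right is nonzero.\<close>
  have "k * q $ i = (Sigma0 N d X *\<^sub>v q) $ i"
    using q i by simp
  also have "\<dots> = (\<Sum>j<d. (\<integral>\<omega>. X 0 \<omega> $ i * X 0 \<omega> $ j \<partial>N) * q $ j)"
    using q(1) i by (auto simp: Sigma0_def scalar_prod_def atLeast0LessThan intro!: sum.cong)
  finally have "(\<Sum>j<d. (\<integral>\<omega>. X 0 \<omega> $ i * X 0 \<omega> $ j \<partial>N) * q $ j) \<noteq> 0"
    using i k by (metis mult_eq_0_iff)
  then obtain j where "(\<integral>\<omega>. X 0 \<omega> $ i * X 0 \<omega> $ j \<partial>N) * q $ j \<noteq> 0"
    by (rule sum.not_neutral_contains_not_neutral)
  then have "(\<integral>\<omega>. X 0 \<omega> $ i * X 0 \<omega> $ j \<partial>N) \<noteq> 0"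
    by (rule contrapos_nn) simp
  then have pos: "0 < (\<integral>\<omega>. (X 0 \<omega> $ i)\<^sup>2 \<partial>N)" (is "0 < ?v")
    using gaussian_coordinate_variance_pos[OF series mean gauss i(1)] by blast
  show ?thesis
  proof (rule rho_coeff_nonneg[OF series, of "\<lambda>v. v $ i / sqrt ?v"])
    show "(\<lambda>v. v $ i / sqrt ?v) \<in> borel_measurable (vec_borel d)"
      using i by measurable
    show "(\<integral>\<omega>. X t \<omega> $ i / sqrt ?v \<partial>N) = 0" for t
      using mean i by (simp add: centered_def)
    show "(\<integral>\<omega>. (X t \<omega> $ i / sqrt ?v)\<^sup>2 \<partial>N) = 1" for t
    proof -
      have "(\<integral>\<omega>. (X t \<omega> $ i)\<^sup>2 \<partial>N) = ?v"
        using i by (intro integral_stationary[OF series stat, of "\<lambda>v. (v $ i)\<^sup>2"]) measurable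
      then show ?thesis
        using pos by (simp add: power_divide)
    qed
  qed
qed

section \<open>Bounds on the oracle inequality and its deviation term\<close>

text \<open>The inequality \<open>(x + y)^2 \<le> 2 x^2 + 2 y^2\<close> removes the root. The factor
  \<open>\<sigma> - 3 * \<eta> - \<gamma>\<close> under the root cancels one such factor of the
  squared denominator, and what remains exceeds half of
  \<open>\<sigma> - 3 * \<eta>\<close>.\<close>

lemma oracle_bound_sq_le:
  assumes \<gamma>: "\<gamma> < (\<sigma> - 3 * \<eta>) / 2" and \<kappa>: "0 < \<sigma> - 3 * \<eta>" and "0 \<le> s" "0 \<le> lam"
  shows "(oracle_bound \<sigma> \<eta> \<gamma> ph s lam)\<^sup>2
    \<le> 4 * (\<gamma> * ph)\<^sup>2 / (\<sigma> - 3 * \<eta>)\<^sup>2 + 4 * (s * lam) / (\<sigma> - 3 * \<eta>)"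
proof -
  define \<kappa> where "\<kappa> = \<sigma> - 3 * \<eta>"
  define \<delta> where "\<delta> = \<kappa> - \<gamma>"
  define x y where "x = \<gamma> * ph" and "y = 4 * \<delta> * s * lam"
  have \<delta>: "\<kappa> / 2 \<le> \<delta>" "0 < \<delta>" and \<kappa>0: "0 < \<kappa>"
    using assms by (auto simp: \<delta>_def \<kappa>_def)
  have y: "0 \<le> y" using \<delta> assms by (simp add: y_def)
  have "(x + sqrt (x\<^sup>2 + y))\<^sup>2 \<le> 2 * x\<^sup>2 + 2 * (sqrt (x\<^sup>2 + y))\<^sup>2"
    using sum_squares_bound[of x "sqrt (x\<^sup>2 + y)"] by (simp add: power2_sum)
  also have "\<dots> = 4 * x\<^sup>2 + 2 * y" using y by simp
  finally have "(oracle_bound \<sigma> \<eta> \<gamma> ph s lam)\<^sup>2 \<le> (4 * x\<^sup>2 + 2 * y) / (2 * \<delta>)\<^sup>2"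
    unfolding oracle_bound_def x_def y_def \<delta>_def \<kappa>_def
    by (simp add: power_divide power_mult_distrib divide_right_mono)
  also have "\<dots> = x\<^sup>2 / \<delta>\<^sup>2 + 2 * (s * lam) / \<delta>"
    using \<delta> by (simp add: y_def field_simps power2_eq_square)
  also have "\<dots> \<le> x\<^sup>2 / (\<kappa> / 2)\<^sup>2 + 2 * (s * lam) / (\<kappa> / 2)"
    using \<delta> \<kappa>0 assms by (intro add_mono divide_left_mono power_mono mult_pos_pos zero_less_power) auto
  also have "\<dots> = 4 * x\<^sup>2 / \<kappa>\<^sup>2 + 4 * (s * lam) / \<kappa>"
    by (simp add: power_divide)
  finally show ?thesis by (simp add: x_def \<kappa>_def)
qed

text \<open>Squaring undoes the root in \<open>zeta_tilde\<close>. The assumption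
  \<open>1 \<le> s\<close> absorbs \<open>b\<close> into a multiple of \<open>s\<close>, and
  nonnegativity of the partial sum lets its bound \<open>C\<close> be squared.\<close>

lemma gamma_tilde_sq_le:
  assumes "0 < b" "0 < c" "1 \<le> s" "1 \<le> d" "0 \<le> (\<Sum>l=0..n. r l)" "(\<Sum>l=0..n. r l) \<le> C"
  shows "(gamma_tilde b c s d n ph r)\<^sup>2 \<le> (b + 4) * C\<^sup>2 / c * (s * ph\<^sup>2 * (ln (real d) / real n))"
proof -
  have L: "0 \<le> ln (real d) / real n" (is "0 \<le> ?L") using assms by simp
  have "(gamma_tilde b c s d n ph r)\<^sup>2 = (ph\<^sup>2 * ?L / c) * ((b + 4 * s) * (\<Sum>l=0..n. r l)\<^sup>2)"
    using assms by (simp add: gamma_tilde_def zeta_tilde_def power_mult_distrib mult_ac)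
  also have "\<dots> \<le> (ph\<^sup>2 * ?L / c) * ((b + 4) * s * C\<^sup>2)"
    using assms L by (intro mult_left_mono mult_mono power_mono) (auto simp: algebra_simps)
  also have "\<dots> = (b + 4) * C\<^sup>2 / c * (s * ph\<^sup>2 * ?L)" by (simp add: mult_ac)
  finally show ?thesis .
qed

section \<open>Stochastic order of the squared estimation error\<close>

theorem corollary5p3:
  fixes M :: "nat \<Rightarrow> 'w measure"
    and p :: "nat \<Rightarrow> nat"
    and X :: "nat \<Rightarrow> int \<Rightarrow> 'w \<Rightarrow> real vec"
    and \<phi> :: "nat \<Rightarrow> nat \<Rightarrow> real"
    and q0 \<beta>0 :: "nat \<Rightarrow> real vec"
    and \<beta>hat :: "nat \<Rightarrow> 'w \<Rightarrow> real vec"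
    and lam0 s s_tilde :: "nat \<Rightarrow> real"
    and \<rho> :: "nat \<Rightarrow> nat \<Rightarrow> real"
    and \<sigma> \<eta> b c :: real
  assumes series: "\<And>n. n \<ge> 1 \<Longrightarrow> time_series (M n) (p n) (X n)"
    and stationary: "\<And>n. n \<ge> 1 \<Longrightarrow> strictly_stationary (M n) (p n) (X n)"
    and zero_mean: "\<And>n. n \<ge> 1 \<Longrightarrow> centered (M n) (p n) (X n)"
    and gaussian: "\<And>n. n \<ge> 1 \<Longrightarrow> gaussian_process (M n) (p n) (X n)"
    and mixing: "\<And>n. n \<ge> 1 \<Longrightarrow> alpha_mixing (M n) (p n) (X n)"
    and rho: "\<And>n. n \<ge> 1 \<Longrightarrow> \<rho> n = rho_coeff (M n) (p n) (X n)"
    and eigenvalues: "\<And>n. n \<ge> 1 \<Longrightarrow> eigenvalue_roots (Sigma0 (M n) (p n) (X n)) (p n) (\<phi> n)"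
    and q0: "\<And>n. n \<ge> 1 \<Longrightarrow> eigenvector (Sigma0 (M n) (p n) (X n)) (q0 n) ((\<phi> n 1)\<^sup>2)"
            "\<And>n. n \<ge> 1 \<Longrightarrow> l2_norm (q0 n) = 1"
    and beta0: "\<And>n. n \<ge> 1 \<Longrightarrow> \<beta>0 n = \<phi> n 1 \<cdot>\<^sub>v q0 n"
    and constants: "0 < 3 * \<eta>" "3 * \<eta> < \<sigma>"
    and gap: "\<And>n j. n \<ge> 1 \<Longrightarrow> 2 \<le> j \<Longrightarrow> j \<le> p n \<Longrightarrow> \<phi> n 1 \<ge> \<phi> n j + \<sigma>"
    and lambda_nonneg: "\<And>n. n \<ge> 1 \<Longrightarrow> lam0 n \<ge> 0"
    and estimator_measurable:
      "\<And>n. n \<ge> 1 \<Longrightarrow> \<beta>hat n \<in> measurable (M n) (vec_borel (p n))"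
    and estimator_penalized:
      "\<And>n \<omega>. n \<ge> 1 \<Longrightarrow> \<omega> \<in> space (M n) \<Longrightarrow>
         is_arg_min (\<lambda>\<beta>. risk (Sigma_hat n (p n) (X n) \<omega>) \<beta> + lam0 n * real (l0_norm \<beta>))
           (\<lambda>\<beta>. \<beta> \<in> vball (\<beta>0 n) \<eta>) (\<beta>hat n \<omega>)"
    and s_nonneg: "\<And>n. n \<ge> 1 \<Longrightarrow> s n \<ge> 0"
    and estimator_constrained:
      "\<And>n \<omega>. n \<ge> 1 \<Longrightarrow> \<omega> \<in> space (M n) \<Longrightarrow>
         is_arg_min (risk (Sigma_hat n (p n) (X n) \<omega>))
           (\<lambda>\<beta>. \<beta> \<in> vball (\<beta>0 n) \<eta> \<and> real (l0_norm \<beta>) \<le> s n) (\<beta>hat n \<omega>)"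
    and s_tilde: "\<And>n. n \<ge> 1 \<Longrightarrow> s_tilde n = max (real (card (vsupport (\<beta>0 n)))) (s n)"
    and c_pos: "c > 0"
    and c_inequality:
      "\<And>b' n. b' > 0 \<Longrightarrow> n \<ge> 1 \<Longrightarrow> p n > 6 \<Longrightarrow>
         (zeta_tilde b' c (s_tilde n) (p n) n)\<^sup>2 < zeta_tilde b' c (s_tilde n) (p n) n \<Longrightarrow>
         gamma_tilde b' c (s_tilde n) (p n) n (\<phi> n 1) (\<rho> n) < \<sigma> - 3 * \<eta> \<Longrightarrow>
         measure (M n) {\<omega> \<in> space (M n). l2_norm (\<beta>hat n \<omega> - \<beta>0 n) \<le>
             oracle_bound \<sigma> \<eta> (gamma_tilde b' c (s_tilde n) (p n) n (\<phi> n 1) (\<rho> n))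
               (\<phi> n 1) (s_tilde n) (lam0 n)}
           \<ge> 1 - exp (- b' * ln (real (p n)))"
    and b_pos: "b > 0"
    and p_gt_6: "\<forall>\<^sub>F n in sequentially. p n > 6"
    and zeta_small: "\<forall>\<^sub>F n in sequentially.
         (zeta_tilde b c (s_tilde n) (p n) n)\<^sup>2 < zeta_tilde b c (s_tilde n) (p n) n"
    and log_p_over_n: "(\<lambda>n. ln (real (p n)) / real n) \<in> o(\<lambda>_. 1)"
    and log_p_to_infinity: "filterlim (\<lambda>n. ln (real (p n))) at_top sequentially"
    and rho_summable: "\<And>n. n \<ge> 1 \<Longrightarrow> summable (\<rho> n)"
    and rho_sum_bounded: "(\<lambda>n. \<Sum>l. \<rho> n l) \<in> O(\<lambda>_. 1)"
    and lambda_rate: "lam0 \<in> \<Theta>(\<lambda>n. (\<phi> n 1)\<^sup>2 * (ln (real (p n)) / real n))"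
  shows "big_O_p M (\<lambda>n \<omega>. (l2_norm (\<beta>hat n \<omega> - \<beta>0 n))\<^sup>2)
           (\<lambda>n. s_tilde n * (\<phi> n 1) ^ 4 * (ln (real (p n)) / real n))"
proof -
  define \<kappa> where "\<kappa> = \<sigma> - 3 * \<eta>"
  have \<kappa>: "0 < \<kappa>" and \<sigma>: "0 < \<sigma>" and \<eta>: "0 < \<eta>"
    using constants by (auto simp: \<kappa>_def)
  define L where "L n = ln (real (p n)) / real n" for n
  obtain C where C: "C > 0" and C_bound: "\<forall>\<^sub>F n in sequentially. norm (\<Sum>l. \<rho> n l) \<le> C"
    using rho_sum_bounded by (auto elim!: landau_o.bigE)
  obtain D where D: "D > 0" and D_bound: "\<forall>\<^sub>F n in sequentially. norm (lam0 n) \<le> D * norm ((\<phi> n 1)\<^sup>2 * L n)"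
    using bigthetaD1[OF lambda_rate] unfolding L_def by (auto elim!: landau_o.bigE)
  \<comment> \<open>The constant of \<open>gamma_tilde_sq_le\<close>.\<close>
  define B where "B = (b + 4) * C\<^sup>2 / c"
  have B: "0 < B" using b_pos c_pos C by (simp add: B_def)
  \<comment> \<open>The first summand serves the case of large \<open>\<gamma>\<close>, where the
    error is at most \<open>\<eta>\<close>; the bracket serves small \<open>\<gamma>\<close>, one
    term for the deviation and one for the penalty.\<close>
  define K where "K = 4 * \<eta>\<^sup>2 * B / (\<sigma>\<^sup>2 * \<kappa>\<^sup>2) + (4 * B / \<kappa>\<^sup>2 + 4 * D / (\<sigma>\<^sup>2 * \<kappa>))"
  have K: "0 < K" using \<kappa> \<sigma> \<eta> B D by (simp add: K_def add_pos_pos)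
  have carrier: "\<beta>0 n \<in> carrier_vec (p n)" if "n \<ge> 1" for n
    using q0(1)[OF that] by (auto simp: beta0[OF that] eigenvector_def Sigma0_def)
  have meas: "(\<lambda>\<omega>. (l2_norm (\<beta>hat n \<omega> - \<beta>0 n))\<^sup>2) \<in> borel_measurable (M n)" if "n \<ge> 1" for n
    using estimator_measurable[OF that] carrier[OF that] by (rule borel_measurable_l2_norm_diff_sq)
  \<comment> \<open>The same \<open>K\<close> works for every \<epsilon>; only the exceptional
    probability \<open>p^(-b)\<close> has to become small.\<close>
  have main: "\<forall>\<^sub>F n in sequentially.
      measure (M n) {\<omega> \<in> space (M n). \<bar>(l2_norm (\<beta>hat n \<omega> - \<beta>0 n))\<^sup>2\<bar>
        \<le> K * \<bar>s_tilde n * (\<phi> n 1) ^ 4 * (ln (real (p n)) / real n)\<bar>} \<ge> 1 - exp (- b * ln (real (p n)))"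
    using p_gt_6 zeta_small C_bound D_bound eventually_ge_at_top[of 1]
  proof eventually_elim
    case (elim n)
    interpret prob_space "M n" using series[OF \<open>1 \<le> n\<close>] by (simp add: time_series_def)
    define ph where "ph = \<phi> n 1"
    \<comment> \<open>A second eigenvalue exists because \<open>p n > 6\<close>, and its root is
      nonnegative.\<close>
    have ph: "\<sigma> \<le> ph"
    proof -
      have "0 \<le> \<phi> n 2"
        using eigenvalues[OF \<open>1 \<le> n\<close>] elim by (auto simp: eigenvalue_roots_def)
      then show ?thesis using gap[of n 2] elim by (simp add: ph_def)
    qed
    have s: "1 \<le> s_tilde n"
    proof -
      have "q0 n \<bullet> q0 n = 1"
        using q0(2)[OF \<open>1 \<le> n\<close>] by (simp add: l2_norm_def)
      then have "l2_norm (\<beta>0 n) \<noteq> 0"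
        using ph \<sigma> q0(1)[OF \<open>1 \<le> n\<close>]
        by (auto simp: beta0[OF \<open>1 \<le> n\<close>] l2_norm_def ph_def eigenvector_def)
      then have "0 < card (vsupport (\<beta>0 n))"
        using l0_norm_pos by (simp add: l0_norm_def)
      then show ?thesis by (simp add: s_tilde[OF \<open>1 \<le> n\<close>] le_max_iff_disj)
    qed
    have L: "0 \<le> L n" using elim by (simp add: L_def)
    define a where "a = s_tilde n * ph ^ 4 * L n"
    have a: "0 \<le> a" using s L by (simp add: a_def)
    \<comment> \<open>Passing from the second to the fourth power of \<open>ph\<close> costs the
      factor \<open>1 / \<sigma>\<^sup>2\<close>.\<close>
    have rate: "s_tilde n * ph\<^sup>2 * L n \<le> a / \<sigma>\<^sup>2"
    proof -
      have "\<sigma>\<^sup>2 * (s_tilde n * ph\<^sup>2 * L n) \<le> ph\<^sup>2 * (s_tilde n * ph\<^sup>2 * L n)"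
        using s L ph \<sigma> by (intro mult_right_mono power_mono) auto
      also have "\<dots> = a" by (simp add: a_def power4_eq_xxxx power2_eq_square)
      finally show ?thesis using \<sigma> by (simp add: field_simps)
    qed
    \<comment> \<open>Nonnegative terms keep the partial sums below the infinite sum, which
      \<open>C\<close> bounds. The eigenvalue \<open>ph\<^sup>2\<close> is nonzero since
      \<open>ph \<ge> \<sigma> > 0\<close>.\<close>
    have rho_nonneg: "0 \<le> \<rho> n l" for l
      unfolding rho[OF \<open>1 \<le> n\<close>]
      using rho_coeff_nonneg_gaussian[OF series stationary zero_mean gaussian q0(1)] ph \<sigma> \<open>1 \<le> n\<close>
      by (simp add: ph_def)
    have rho_sum: "0 \<le> (\<Sum>l=0..n. \<rho> n l)" "(\<Sum>l=0..n. \<rho> n l) \<le> C"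
    proof -
      show "0 \<le> (\<Sum>l=0..n. \<rho> n l)" by (simp add: sum_nonneg rho_nonneg)
      have "(\<Sum>l=0..n. \<rho> n l) \<le> (\<Sum>l. \<rho> n l)"
        using rho_summable[OF \<open>1 \<le> n\<close>] rho_nonneg by (intro sum_le_suminf) auto
      with elim show "(\<Sum>l=0..n. \<rho> n l) \<le> C" by simp
    qed
    define \<gamma> where "\<gamma> = gamma_tilde b c (s_tilde n) (p n) n ph (\<rho> n)"
    have \<gamma>: "\<gamma>\<^sup>2 \<le> B * (s_tilde n * ph\<^sup>2 * L n)"
      unfolding \<gamma>_def B_def L_def using elim
      by (intro gamma_tilde_sq_le b_pos c_pos s rho_sum) auto
    define E where "E = {\<omega> \<in> space (M n). \<bar>(l2_norm (\<beta>hat n \<omega> - \<beta>0 n))\<^sup>2\<bar> \<le> K * \<bar>a\<bar>}"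
    have "E \<in> events"
      unfolding E_def using meas[OF \<open>1 \<le> n\<close>] by measurable
    have "1 - exp (- b * ln (real (p n))) \<le> prob E"
    proof (cases "\<gamma> < \<kappa> / 2")
      case True
      define U where "U = oracle_bound \<sigma> \<eta> \<gamma> ph (s_tilde n) (lam0 n)"
      have "U\<^sup>2 \<le> 4 * (\<gamma> * ph)\<^sup>2 / \<kappa>\<^sup>2 + 4 * (s_tilde n * lam0 n) / \<kappa>"
        unfolding U_def \<kappa>_def using True \<kappa> s lambda_nonneg[OF \<open>1 \<le> n\<close>]
        by (intro oracle_bound_sq_le) (auto simp: \<kappa>_def)
      \<comment> \<open>The deviation term reaches \<open>ph ^ 4\<close> through its extra factor
        \<open>ph\<^sup>2\<close>; the penalty term has only \<open>ph\<^sup>2\<close> and needs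
        \<open>rate\<close>.\<close>
      also have "\<dots> \<le> 4 * (B * a) / \<kappa>\<^sup>2 + 4 * (D * (a / \<sigma>\<^sup>2)) / \<kappa>"
      proof (intro add_mono divide_right_mono mult_left_mono)
        have "(\<gamma> * ph)\<^sup>2 \<le> B * (s_tilde n * ph\<^sup>2 * L n) * ph\<^sup>2"
          using \<gamma> by (simp add: power_mult_distrib mult_right_mono)
        also have "\<dots> = B * a" by (simp add: a_def power4_eq_xxxx power2_eq_square)
        finally show "(\<gamma> * ph)\<^sup>2 \<le> B * a" .
        have "lam0 n \<le> D * (ph\<^sup>2 * L n)"
          using elim L by (simp add: ph_def)
        then have "s_tilde n * lam0 n \<le> s_tilde n * (D * (ph\<^sup>2 * L n))"
          using s by (intro mult_left_mono) auto
        also have "\<dots> = D * (s_tilde n * ph\<^sup>2 * L n)" by simp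
        also have "\<dots> \<le> D * (a / \<sigma>\<^sup>2)" using rate D by (intro mult_left_mono) auto
        finally show "s_tilde n * lam0 n \<le> D * (a / \<sigma>\<^sup>2)" .
      qed (use \<kappa> in auto)
      also have "\<dots> = (4 * B / \<kappa>\<^sup>2 + 4 * D / (\<sigma>\<^sup>2 * \<kappa>)) * a"
        by (simp add: algebra_simps)
      also have "\<dots> \<le> K * a"
        using a B by (intro mult_right_mono) (auto simp: K_def)
      finally have U: "U\<^sup>2 \<le> K * a" .
      have "1 - exp (- b * ln (real (p n)))
          \<le> prob {\<omega> \<in> space (M n). l2_norm (\<beta>hat n \<omega> - \<beta>0 n) \<le> U}"
        unfolding U_def \<gamma>_def ph_def
        using True \<kappa> elim by (intro c_inequality b_pos) (auto simp: \<gamma>_def ph_def \<kappa>_def)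
      also have "\<dots> \<le> prob E"
      proof (rule finite_measure_mono[OF _ \<open>E \<in> events\<close>], safe)
        fix \<omega> assume "\<omega> \<in> space (M n)" "l2_norm (\<beta>hat n \<omega> - \<beta>0 n) \<le> U"
        moreover from this have "(l2_norm (\<beta>hat n \<omega> - \<beta>0 n))\<^sup>2 \<le> U\<^sup>2"
          by (intro power_mono l2_norm_nonneg)
        ultimately show "\<omega> \<in> E" using U a by (simp add: E_def)
      qed
      finally show ?thesis .
    next
      case False
      \<comment> \<open>Large \<open>\<gamma>\<close> bounds \<open>a\<close> below by
        \<open>\<sigma>\<^sup>2 * \<kappa>\<^sup>2 / (4 * B)\<close>, so that the fixed number
        \<open>\<eta>\<^sup>2\<close> is at most \<open>K * a\<close>.\<close>
      have "(\<kappa> / 2)\<^sup>2 \<le> \<gamma>\<^sup>2" using False \<kappa> by (intro power_mono) auto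
      also have "\<dots> \<le> B * (a / \<sigma>\<^sup>2)"
        using \<gamma> mult_left_mono[OF rate, of B] B by linarith
      finally have "1 \<le> 4 * B / (\<sigma>\<^sup>2 * \<kappa>\<^sup>2) * a"
        using \<kappa> \<sigma> by (simp add: field_simps power_divide)
      then have "\<eta>\<^sup>2 * 1 \<le> \<eta>\<^sup>2 * (4 * B / (\<sigma>\<^sup>2 * \<kappa>\<^sup>2) * a)"
        by (intro mult_left_mono) auto
      also have "\<dots> = 4 * \<eta>\<^sup>2 * B / (\<sigma>\<^sup>2 * \<kappa>\<^sup>2) * a" by simp
      also have "\<dots> \<le> K * a"
        using a B D \<kappa> \<sigma> by (intro mult_right_mono) (auto simp: K_def)
      finally have \<eta>_le: "\<eta>\<^sup>2 \<le> K * a" by simp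
      \<comment> \<open>The estimator is confined to a ball of radius \<open>\<eta>\<close> around
        \<open>\<beta>0 n\<close>, so here the bound holds surely.\<close>
      have "space (M n) \<subseteq> E"
      proof
        fix \<omega> assume \<omega>: "\<omega> \<in> space (M n)"
        then have "\<beta>hat n \<omega> \<in> vball (\<beta>0 n) \<eta>"
          using estimator_penalized[OF \<open>1 \<le> n\<close>] by (auto simp: is_arg_min_def)
        then have "(l2_norm (\<beta>hat n \<omega> - \<beta>0 n))\<^sup>2 \<le> \<eta>\<^sup>2"
          by (intro power_mono l2_norm_nonneg) (simp add: vball_def)
        with \<eta>_le a \<omega> show "\<omega> \<in> E" by (simp add: E_def)
      qed
      then have "E = space (M n)" by (auto simp: E_def)
      then show ?thesis by (simp add: prob_space)
    qed
    then show ?case by (simp add: E_def a_def ph_def L_def)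
  qed
  have "((\<lambda>n. exp (- b * ln (real (p n)))) \<longlongrightarrow> 0) sequentially"
    using filterlim_tendsto_pos_mult_at_top[OF tendsto_const b_pos log_p_to_infinity]
    by (intro filterlim_compose[OF exp_at_bot]) (simp add: filterlim_uminus_at_top)
  then have tail: "\<forall>\<^sub>F n in sequentially. exp (- b * ln (real (p n))) < \<epsilon>" if "0 < \<epsilon>" for \<epsilon>
    using that by (rule order_tendstoD)
  show ?thesis
    unfolding big_O_p_def
  proof (intro conjI allI impI)
    fix \<epsilon> :: real assume "0 < \<epsilon>"
    from main tail[OF this]
    have "\<forall>\<^sub>F n in sequentially. measure (M n) {\<omega> \<in> space (M n). \<bar>(l2_norm (\<beta>hat n \<omega> - \<beta>0 n))\<^sup>2\<bar>
        \<le> K * \<bar>s_tilde n * (\<phi> n 1) ^ 4 * (ln (real (p n)) / real n)\<bar>} \<ge> 1 - \<epsilon>"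
      by eventually_elim linarith
    with K show "\<exists>K>0. \<forall>\<^sub>F n in sequentially. measure (M n) {\<omega> \<in> space (M n).
        \<bar>(l2_norm (\<beta>hat n \<omega> - \<beta>0 n))\<^sup>2\<bar>
          \<le> K * \<bar>s_tilde n * (\<phi> n 1) ^ 4 * (ln (real (p n)) / real n)\<bar>} \<ge> 1 - \<epsilon>"
      by blast
  qed (rule meas)
qed

end
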